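(* Let $\mathscr{F}\subseteq\mathscr{P}(\omega)$ be a nonempty $\omega$-closed family and let $(i_1,j_1,F_1)$ and $(i_2,j_2,F_2)$ be non-zero elements of the semigroup $\boldsymbol{B}_{\omega}^{\mathscr{F}}$. Then $(i_1,j_1,F_1)\preccurlyeq(i_2,j_2,F_2)$ if and only if $F_1\subseteq -k+F_2$ and $i_1-i_2=j_1-j_2=k$ for some $k\in\omega$.
   Context: $\omega$ is the set of non-negative integers, $\mathscr{P}(\omega)$ its power set. For an integer $n$ and $F\subseteq\omega$ put $n+F=\{n+k\colon k\in F\}\subseteq\mathbb{Z}$ (empty if $F=\varnothing$). A family $\mathscr{F}\subseteq\mathscr{P}(\omega)$ is $\omega$-closed if $F_1\cap(-n+F_2)\in\mathscr{F}$ for all $n\in\omega$ and $F_1,F_2\in\mathscr{F}$. For an $\omega$-closed family $\mathscr{F}$, the set $\boldsymbol{B}_{\omega}\times\mathscr{F}=\omega\times\omega\times\mathscr{F}$ carries the semigroup operation $$(i_1,j_1,F_1)\cdot(i_2,j_2,F_2)=\begin{cases}(i_1-j_1+i_2,\,j_2,\,(j_1-i_2+F_1)\cap F_2), & j_1\leqslant i_2;\\ (i_1,\,j_1-i_2+j_2,\,F_1\cap(i_2-j_1+F_2)), & j_1\geqslant i_2.\end{cases}$$ If $\varnothing\notin\mathscr{F}$, then $\boldsymbol{B}_{\omega}^{\mathscr{F}}=(\boldsymbol{B}_{\omega}\times\mathscr{F},\cdot)$. If $\varnothing\in\mathscr{F}$, then $\boldsymbol{I}=\{(i,j,\varnothing)\colon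 i,j\in\omega\}$ is an ideal and $\boldsymbol{B}_{\omega}^{\mathscr{F}}$ is the Rees quotient $(\boldsymbol{B}_{\omega}\times\mathscr{F},\cdot)/\boldsymbol{I}$, in which all $(i,j,\varnothing)$ are identified to a single zero element $\boldsymbol{0}$; the non-zero elements are the $(i,j,F)$ with $F\neq\varnothing$. $\boldsymbol{B}_{\omega}^{\mathscr{F}}$ is an inverse semigroup, and $\preccurlyeq$ is its natural partial order: $s\preccurlyeq t$ if and only if $s=te$ for some idempotent $e$. *)

theory Defs
  imports Complex_Main
begin

text \<open>Subsets of \<open>\<omega>\<close> are of type \<^typ>\<open>nat set\<close>, whereas the translate \<open>n + F\<close> may contain negative
  integers and is of type \<^typ>\<open>int set\<close>. The intersection of a translate with a subset of \<open>\<omega>\<close> is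
  formed after taking the preimage of the translate under the embedding \<^const>\<open>int\<close>.\<close>

definition translate :: "int \<Rightarrow> nat set \<Rightarrow> int set" where
  "translate n F = {n + int k | k. k \<in> F}"

definition omega_closed :: "nat set set \<Rightarrow> bool" where
  "omega_closed \<F> \<longleftrightarrow>
     (\<forall>n. \<forall>F1\<in>\<F>. \<forall>F2\<in>\<F>. F1 \<inter> int -` translate (- int n) F2 \<in> \<F>)"

type_synonym triple = "nat \<times> nat \<times> nat set"

definition triples :: "nat set set \<Rightarrow> triple set" where
  "triples \<F> = UNIV \<times> UNIV \<times> \<F>"

text \<open>No subtraction of natural numbers below is truncated.\<close>

fun triple_mult :: "triple \<Rightarrow> triple \<Rightarrow> triple" where
  "triple_mult (i1, j1, F1) (i2, j2, F2) =
     (if j1 \<le> i2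
      then (i1 + (i2 - j1), j2, int -` translate (int j1 - int i2) F1 \<inter> F2)
      else (i1, (j1 - i2) + j2, F1 \<inter> int -` translate (int i2 - int j1) F2))"


text \<open>The Rees quotient of a semigroup with carrier \<open>S\<close> and product \<open>f\<close> by an ideal \<open>I\<close>. For
  \<open>I = {}\<close> all classes are singletons, so the quotient is \<open>S\<close> itself up to \<open>a \<mapsto> {a}\<close>.\<close>

definition rees_congruence :: "'a set \<Rightarrow> 'a set \<Rightarrow> 'a rel" where
  "rees_congruence S I = {(a, b). a \<in> S \<and> b \<in> S \<and> (a = b \<or> a \<in> I \<and> b \<in> I)}"

definition rees_carrier :: "'a set \<Rightarrow> 'a set \<Rightarrow> 'a set set" where
  "rees_carrier S I = S // rees_congruence S I"

definition rees_mult ::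
    "'a set \<Rightarrow> ('a \<Rightarrow> 'a \<Rightarrow> 'a) \<Rightarrow> 'a set \<Rightarrow> 'a set \<Rightarrow> 'a set \<Rightarrow> 'a set" where
  "rees_mult S f I A B = (\<Union>a\<in>A. \<Union>b\<in>B. rees_congruence S I `` {f a b})"

definition natural_le :: "'a set \<Rightarrow> ('a \<Rightarrow> 'a \<Rightarrow> 'a) \<Rightarrow> 'a \<Rightarrow> 'a \<Rightarrow> bool" where
  "natural_le S f s t \<longleftrightarrow> s \<in> S \<and> t \<in> S \<and> (\<exists>e\<in>S. f e e = e \<and> s = f t e)"


text \<open>The semigroup \<open>B\<^sub>\<omega>\<^sup>\<F>\<close>. The ideal of triples with empty third component is empty if
  \<open>{} \<notin> \<F>\<close>, so both cases of the definition are instances of the Rees quotient.\<close>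

definition empty_triples :: "nat set set \<Rightarrow> triple set" where
  "empty_triples \<F> = {(i, j, F). F \<in> \<F> \<and> F = {}}"

definition BF_carrier :: "nat set set \<Rightarrow> triple set set" where
  "BF_carrier \<F> = rees_carrier (triples \<F>) (empty_triples \<F>)"

definition BF_mult :: "nat set set \<Rightarrow> triple set \<Rightarrow> triple set \<Rightarrow> triple set" where
  "BF_mult \<F> = rees_mult (triples \<F>) triple_mult (empty_triples \<F>)"

definition BF_elem :: "nat set set \<Rightarrow> triple \<Rightarrow> triple set" where
  "BF_elem \<F> a = rees_congruence (triples \<F>) (empty_triples \<F>) `` {a}"

definition BF_le :: "nat set set \<Rightarrow> triple set \<Rightarrow> triple set \<Rightarrow> bool" where
  "BF_le \<F> = natural_le (BF_carrier \<F>) (BF_mult \<F>)"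


lemma mem_translate_int [simp]:
  "int x \<in> translate n F \<longleftrightarrow> (\<exists>k\<in>F. int x = n + int k)"
  by (auto simp: translate_def)

lemma triple_mult_closed:
  assumes "omega_closed \<F>" "a \<in> triples \<F>" "b \<in> triples \<F>"
  shows "triple_mult a b \<in> triples \<F>"
proof -
  obtain i1 j1 F1 i2 j2 F2 where ab: "a = (i1, j1, F1)" "b = (i2, j2, F2)"
    by (metis prod_cases3)
  have F: "F1 \<in> \<F>" "F2 \<in> \<F>"
    using assms ab by (auto simp: triples_def)
  have "F2 \<inter> int -` translate (- int (i2 - j1)) F1 \<in> \<F>"
       "F1 \<inter> int -` translate (- int (j1 - i2)) F2 \<in> \<F>"
    using assms(1) F unfolding omega_closed_def by blast+
  then show ?thesis
    by (auto simp: ab triples_def of_nat_diff Int_commute)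
qed

lemma triple_mult_assoc:
  "triple_mult (triple_mult a b) c = triple_mult a (triple_mult b c)"
proof -
  obtain i1 j1 F1 i2 j2 F2 i3 j3 F3
    where abc: "a = (i1, j1, F1)" "b = (i2, j2, F2)" "c = (i3, j3, F3)"
    by (metis prod_cases3)
  show ?thesis
    unfolding abc
    by (auto simp: of_nat_diff algebra_simps; (rule bexI[rotated], assumption, linarith))
qed

lemma equiv_rees_congruence: "equiv S (rees_congruence S I)"
  by (rule equivI) (auto simp: rees_congruence_def refl_on_def intro: symI transI)

lemma triple_mult_empty:
  assumes "omega_closed \<F>" "a \<in> triples \<F>" "b \<in> triples \<F>"
    and "a \<in> empty_triples \<F> \<or> b \<in> empty_triples \<F>"
  shows "triple_mult a b \<in> empty_triples \<F>"
  using triple_mult_closed[OF assms(1-3)] assms(4)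
  by (cases a; cases b) (auto simp: empty_triples_def triples_def split: if_splits)

lemma BF_mult_elem:
  assumes "omega_closed \<F>" "a \<in> triples \<F>" "b \<in> triples \<F>"
  shows "BF_mult \<F> (BF_elem \<F> a) (BF_elem \<F> b) = BF_elem \<F> (triple_mult a b)"
proof -
  let ?S = "triples \<F>" and ?I = "empty_triples \<F>"
  let ?r = "rees_congruence ?S ?I"
  have eq: "?r `` {triple_mult a' b'} = ?r `` {triple_mult a b}"
    if "(a, a') \<in> ?r" "(b, b') \<in> ?r" for a' b'
  proof -
    have "(triple_mult a' b', triple_mult a b) \<in> ?r"
      using that triple_mult_closed[OF assms(1)] triple_mult_empty[OF assms(1)]
      unfolding rees_congruence_def mem_Collect_eq prod.case by metis
    then show ?thesis
      by (rule equiv_class_eq[OF equiv_rees_congruence])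
  qed
  have "(a, a) \<in> ?r" "(b, b) \<in> ?r"
    using assms by (auto simp: rees_congruence_def)
  then have ne: "?r `` {a} \<noteq> {}" "?r `` {b} \<noteq> {}"
    by blast+
  have "rees_mult ?S triple_mult ?I (?r `` {a}) (?r `` {b}) =
      (\<Union>a'\<in>?r `` {a}. \<Union>b'\<in>?r `` {b}. ?r `` {triple_mult a b})"
    unfolding rees_mult_def by (intro SUP_cong refl eq) simp_all
  also have "\<dots> = ?r `` {triple_mult a b}"
    using ne by simp
  finally show ?thesis
    unfolding BF_mult_def BF_elem_def .
qed

end

theory Submission
  imports Defs
begin

text \<open>The Rees congruence only merges triples with empty third component, so equations between
  non-zero elements, and hence the order below a non-zero element, can be read off from triples
  (\<open>BF_le_nonzero\<close>). There the non-zero idempotents are the \<open>(i, i, F)\<close>, because squaring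
  \<open>(i, j, F)\<close> with \<open>i \<noteq> j\<close> changes one of the first two components. Multiplying
  \<open>(i\<^sub>2, j\<^sub>2, F\<^sub>2)\<close> on the right by \<open>(i, i, F)\<close> raises both \<open>i\<^sub>2\<close> and \<open>j\<^sub>2\<close> by
  \<open>k = max 0 (i - j\<^sub>2)\<close> and leaves a set contained in \<open>-k + F\<^sub>2\<close>; conversely, the idempotent
  \<open>(j\<^sub>1, j\<^sub>1, F\<^sub>1)\<close> cuts \<open>(i\<^sub>2, j\<^sub>2, F\<^sub>2)\<close> down to any \<open>(i\<^sub>1, j\<^sub>1, F\<^sub>1)\<close> that
  satisfies the condition.\<close>

lemma BF_carrier_eq: "BF_carrier \<F> = BF_elem \<F> ` triples \<F>"
  by (auto simp: BF_carrier_def rees_carrier_def quotient_def BF_elem_def)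

lemma BF_elem_eq_iff:
  assumes "a \<in> triples \<F>" "b \<in> triples \<F>" "a \<notin> empty_triples \<F>"
  shows "BF_elem \<F> a = BF_elem \<F> b \<longleftrightarrow> a = b"
  unfolding BF_elem_def eq_equiv_class_iff[OF equiv_rees_congruence assms(1,2)]
  using assms by (auto simp: rees_congruence_def)

lemma triple_mult_idem_iff:
  "triple_mult (i, j, F) (i, j, F) = (i, j, F) \<longleftrightarrow> i = j"
  by auto

text \<open>An idempotent \<open>e\<close> with \<open>a = b \<cdot> e\<close> and \<open>a \<noteq> \<zero>\<close> is itself non-zero, so only the idempotents
  \<open>(i, i, F)\<close> need be considered, and both \<open>e \<cdot> e = e\<close> and \<open>a = b \<cdot> e\<close> hold already for the
  representing triples.\<close>

lemma BF_le_nonzero: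
  assumes "omega_closed \<F>" "a \<in> triples \<F>" "b \<in> triples \<F>" "a \<notin> empty_triples \<F>"
  shows "BF_le \<F> (BF_elem \<F> a) (BF_elem \<F> b) \<longleftrightarrow>
    (\<exists>i. \<exists>F\<in>\<F>. a = triple_mult b (i, i, F))"
proof -
  have "BF_le \<F> (BF_elem \<F> a) (BF_elem \<F> b) \<longleftrightarrow>
      (\<exists>e\<in>triples \<F>. BF_elem \<F> (triple_mult e e) = BF_elem \<F> e \<and>
         BF_elem \<F> a = BF_elem \<F> (triple_mult b e))"
    using assms by (auto simp: BF_le_def natural_le_def BF_carrier_eq BF_mult_elem)
  also have "\<dots> \<longleftrightarrow> (\<exists>e\<in>triples \<F>. triple_mult e e = e \<and> a = triple_mult b e)"
  proof (intro bex_cong refl)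
    fix e assume e: "e \<in> triples \<F>"
    have prod: "BF_elem \<F> a = BF_elem \<F> (triple_mult b e) \<longleftrightarrow> a = triple_mult b e"
      by (rule BF_elem_eq_iff) (use assms e triple_mult_closed in auto)
    have idem: "BF_elem \<F> (triple_mult e e) = BF_elem \<F> e \<longleftrightarrow> triple_mult e e = e"
      if "a = triple_mult b e"
    proof -
      have "e \<notin> empty_triples \<F>"
        using triple_mult_empty[OF assms(1,3) e] assms(4) that by auto
      then have "BF_elem \<F> e = BF_elem \<F> (triple_mult e e) \<longleftrightarrow> e = triple_mult e e"
        using BF_elem_eq_iff e triple_mult_closed[OF assms(1) e e] by blast
      then show ?thesis
        by (simp only: eq_commute)
    qed
    show "(BF_elem \<F> (triple_mult e e) = BF_elem \<F> e \<and>
        BF_elem \<F> a = BF_elem \<F> (triple_mult b e)) \<longleftrightarrow>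
        (triple_mult e e = e \<and> a = triple_mult b e)"
      using prod idem by blast
  qed
  also have "\<dots> \<longleftrightarrow> (\<exists>i. \<exists>F\<in>\<F>. a = triple_mult b (i, i, F))"
  proof
    assume "\<exists>e\<in>triples \<F>. triple_mult e e = e \<and> a = triple_mult b e"
    then obtain i j F where "F \<in> \<F>" "triple_mult (i, j, F) (i, j, F) = (i, j, F)"
        "a = triple_mult b (i, j, F)"
      unfolding triples_def by blast
    then show "\<exists>i. \<exists>F\<in>\<F>. a = triple_mult b (i, i, F)"
      using triple_mult_idem_iff by metis
  next
    assume "\<exists>i. \<exists>F\<in>\<F>. a = triple_mult b (i, i, F)"
    then obtain i F where "F \<in> \<F>" "a = triple_mult b (i, i, F)"
      by blast
    then show "\<exists>e\<in>triples \<F>. triple_mult e e = e \<and> a = triple_mult b e"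
      using triple_mult_idem_iff by (intro bexI[of _ "(i, i, F)"]) (auto simp: triples_def)
  qed
  finally show ?thesis .
qed

theorem mainTheorem3:
  fixes \<F> :: "nat set set" and i1 j1 i2 j2 :: nat and F1 F2 :: "nat set"
  assumes "\<F> \<noteq> {}" and "omega_closed \<F>"
    and "(i1, j1, F1) \<in> triples \<F>" and "F1 \<noteq> {}"
    and "(i2, j2, F2) \<in> triples \<F>" and "F2 \<noteq> {}"
  shows "BF_le \<F> (BF_elem \<F> (i1, j1, F1)) (BF_elem \<F> (i2, j2, F2)) \<longleftrightarrow>
    (\<exists>k::nat. int ` F1 \<subseteq> translate (- int k) F2 \<and>
       int i1 - int i2 = int j1 - int j2 \<and> int j1 - int j2 = int k)"
    (is "?le \<longleftrightarrow> ?shift")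
proof -
  have "(i1, j1, F1) \<notin> empty_triples \<F>"
    using assms(4) by (simp add: empty_triples_def)
  then have le: "?le \<longleftrightarrow>
      (\<exists>i. \<exists>F\<in>\<F>. (i1, j1, F1) = triple_mult (i2, j2, F2) (i, i, F))"
    using BF_le_nonzero assms by blast
  show ?thesis
  proof
    assume ?le
    then obtain i F where e: "(i1, j1, F1) = triple_mult (i2, j2, F2) (i, i, F)"
      using le by blast
    show ?shift
    proof (cases "j2 \<le> i")
      case True
      then have F1: "F1 = int -` translate (- int (i - j2)) F2 \<inter> F"
        and "i1 = i2 + (i - j2)" "j1 = i"
        using e by (auto simp: of_nat_diff)
      moreover have "int ` F1 \<subseteq> translate (- int (i - j2)) F2"
        using F1 by blast
      ultimately show ?thesis
        using True by (intro exI[of _ "i - j2"]) auto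
    next
      case False
      then have "F1 \<subseteq> F2" "i1 = i2" "j1 = j2"
        using e by auto
      then show ?thesis
        by (intro exI[of _ 0]) auto
    qed
  next
    assume ?shift
    then obtain k :: nat where sub: "int ` F1 \<subseteq> translate (- int k) F2"
      and ij: "i1 = i2 + k" "j1 = j2 + k"
      by auto
    have "int -` translate (- int k) F2 \<inter> F1 = F1"
      using sub by blast
    then have "(i1, j1, F1) = triple_mult (i2, j2, F2) (j1, j1, F1)"
      using ij by simp
    moreover have "F1 \<in> \<F>"
      using assms(3) by (simp add: triples_def)
    ultimately show ?le
      using le by blast
  qed
qed

end
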